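(* For all integers $m\ge 5$ and $k\ge -1$, $M(m,2m+2k-1)\le 3m+k-3$.
   Context: Let $a_1<\cdots<a_m$ and $b_1<\cdots<b_n$ be two sorted lists whose $m+n$ elements are distinct and whose interleaving is unknown. A deterministic merging algorithm learns information only through pairwise comparisons between elements and must determine the full linear order of all $m+n$ elements. $M(m,n)$ is the minimum over all such algorithms of the worst-case number of comparisons used. *)

theory Defs
  imports Main
begin

datatype elt = A nat | B nat

definition elts :: "nat \<Rightarrow> nat \<Rightarrow> elt set" where
  "elts m n = A ` {1..m} \<union> B ` {1..n}"

text \<open>
  An input is identified with the strict linear order that it induces on the \<open>m + n\<close> elements:
  comparisons reveal nothing else, and \<open>(x, y) \<in> r\<close> means that \<open>x\<close> is smaller than \<open>y\<close>.
  The inclusion in the product is needed because \<^const>\<open>strict_linear_order_on\<close> does not restrict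
  the field of the relation.
\<close>

definition interleavings :: "nat \<Rightarrow> nat \<Rightarrow> elt rel set" where
  "interleavings m n =
     {r. r \<subseteq> elts m n \<times> elts m n \<and> strict_linear_order_on (elts m n) r \<and>
         (\<forall>i j. 1 \<le> i \<and> i < j \<and> j \<le> m \<longrightarrow> (A i, A j) \<in> r) \<and>
         (\<forall>i j. 1 \<le> i \<and> i < j \<and> j \<le> n \<longrightarrow> (B i, B j) \<in> r)}"

text \<open>
  A deterministic adaptive algorithm is a binary decision tree; the first subtree of
  \<open>Compare x y\<close> is taken if \<open>x\<close> is smaller than \<open>y\<close>, the second one otherwise.
  Any two distinct elements may be compared, also two from the same list.
\<close>

datatype alg = Output "elt rel" | Compare elt elt alg alg

primrec valid_alg :: "elt set \<Rightarrow> alg \<Rightarrow> bool" where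
  "valid_alg E (Output s) = True"
| "valid_alg E (Compare x y t u) =
     (x \<in> E \<and> y \<in> E \<and> x \<noteq> y \<and> valid_alg E t \<and> valid_alg E u)"

primrec result :: "alg \<Rightarrow> elt rel \<Rightarrow> elt rel" where
  "result (Output s) r = s"
| "result (Compare x y t u) r = (if (x, y) \<in> r then result t r else result u r)"

primrec comparisons :: "alg \<Rightarrow> elt rel \<Rightarrow> nat" where
  "comparisons (Output s) r = 0"
| "comparisons (Compare x y t u) r =
     Suc (if (x, y) \<in> r then comparisons t r else comparisons u r)"

definition merge_alg :: "nat \<Rightarrow> nat \<Rightarrow> alg \<Rightarrow> bool" where
  "merge_alg m n t \<longleftrightarrow>
     valid_alg (elts m n) t \<and> (\<forall>r \<in> interleavings m n. result t r = r)"

definition worst_case :: "nat \<Rightarrow> nat \<Rightarrow> alg \<Rightarrow> nat" where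
  "worst_case m n t = Max (comparisons t ` interleavings m n)"

definition M :: "nat \<Rightarrow> nat \<Rightarrow> nat" where
  "M m n = (LEAST c. \<exists>t. merge_alg m n t \<and> worst_case m n t = c)"

text \<open>The maximum and the minimum above range over nonempty sets, the former also finite.\<close>

lemma finite_elts: "finite (elts m n)"
  by (simp add: elts_def)

lemma finite_interleavings: "finite (interleavings m n)"
  by (rule finite_subset[of _ "Pow (elts m n \<times> elts m n)"])
    (auto simp: interleavings_def finite_elts)

lemma interleavings_nonempty: "interleavings m n \<noteq> {}"
proof -
  define r where "r = {(x, y). x \<in> elts m n \<and> y \<in> elts m n \<and>
    (case x of A i \<Rightarrow> (case y of A j \<Rightarrow> i < j | B j \<Rightarrow> True)
             | B i \<Rightarrow> (case y of A j \<Rightarrow> False | B j \<Rightarrow> i < j))}"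
  have "trans r" "irrefl r" "total_on (elts m n) r"
    by (auto simp: r_def trans_def irrefl_def total_on_def split: elt.splits)
  moreover have "r \<subseteq> elts m n \<times> elts m n"
    by (auto simp: r_def)
  moreover have "(A i, A j) \<in> r" if "1 \<le> i" "i < j" "j \<le> m" for i j
    using that by (simp add: r_def elts_def)
  moreover have "(B i, B j) \<in> r" if "1 \<le> i" "i < j" "j \<le> n" for i j
    using that by (simp add: r_def elts_def)
  ultimately have "r \<in> interleavings m n"
    by (simp add: interleavings_def strict_linear_order_on_def)
  then show ?thesis by blast
qed

lemma ex_merge_alg: "\<exists>t. merge_alg m n t"
proof -
  have "\<exists>t. valid_alg E t \<and> (\<forall>r. result t r = s \<union> (set ps \<inter> r))"
    if "\<forall>(x, y) \<in> set ps. x \<in> E \<and> y \<in> E \<and> x \<noteq> y" for E s and ps :: "(elt \<times> elt) list"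
    using that
  proof (induction ps arbitrary: s)
    case Nil
    then show ?case by (auto intro: exI[of _ "Output s"])
  next
    case (Cons p ps)
    obtain x y where p: "p = (x, y)" by fastforce
    have ps: "\<forall>(x, y) \<in> set ps. x \<in> E \<and> y \<in> E \<and> x \<noteq> y"
      using Cons.prems by simp
    obtain t where "valid_alg E t" "\<forall>r. result t r = insert (x, y) s \<union> (set ps \<inter> r)"
      using Cons.IH[OF ps] by blast
    moreover obtain u where "valid_alg E u" "\<forall>r. result u r = s \<union> (set ps \<inter> r)"
      using Cons.IH[OF ps] by blast
    ultimately show ?case
      using Cons.prems p by (intro exI[of _ "Compare x y t u"]) auto
  qed
  note tree = this
  have "finite {(x, y). x \<in> elts m n \<and> y \<in> elts m n \<and> x \<noteq> y}"
    by (rule finite_subset[of _ "elts m n \<times> elts m n"]) (auto simp: finite_elts)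
  then obtain ps where ps: "set ps = {(x, y). x \<in> elts m n \<and> y \<in> elts m n \<and> x \<noteq> y}"
    using finite_list by blast
  then obtain t where "valid_alg (elts m n) t" "\<And>r. result t r = set ps \<inter> r"
    using tree[of ps "elts m n" "{}"] by auto
  moreover have "set ps \<inter> r = r" if "r \<in> interleavings m n" for r
    using that by (auto simp: ps interleavings_def strict_linear_order_on_def irrefl_def)
  ultimately show ?thesis
    by (auto simp: merge_alg_def)
qed

end

theory Submission imports Defs begin

text \<open>
  Comparing \<open>A 1\<close> with \<open>B 2\<close>, and with \<open>B 1\<close> if it is smaller, shows that \<open>M m (n + 2)\<close> is at most the
  maximum of \<open>M m n + 1\<close> and \<open>M (m - 1) (n + 2) + 2\<close>. The claimed bound is stable under this
  recursion, which ends in the case \<open>k = - 1\<close>, where linear merging suffices, and in the case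
  \<open>m = 5\<close>. There the Hwang--Lin bound suffices for \<open>n \<ge> 23\<close>, and explicit procedures are given for
  the odd \<open>n\<close> from 9 to 21.
\<close>

section \<open>Searching for a list of positions\<close>

text \<open>
  An interleaving is encoded by the sorted list whose entry \<open>xs ! i\<close> is the number of elements of the
  second list below \<open>A (i + 1)\<close>. Thus the query \<open>xs ! i < j\<close> is the comparison of \<open>A (i + 1)\<close> and \<open>B j\<close>.
\<close>

inductive sortable :: "nat \<Rightarrow> nat \<Rightarrow> nat list set \<Rightarrow> bool" for m where
  unique: "(\<And>xs ys. xs \<in> S \<Longrightarrow> ys \<in> S \<Longrightarrow> xs = ys) \<Longrightarrow> sortable m c S"
| query: "i < m \<Longrightarrow> sortable m c {xs \<in> S. xs ! i < j} \<Longrightarrow> sortable m c {xs \<in> S. j \<le> xs ! i}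
    \<Longrightarrow> sortable m (Suc c) S"

text \<open>A search tree for \<open>S\<close> is run on \<open>g xs\<close>, each query being
  replaced by a query on \<open>xs\<close> itself. Since \<open>g\<close> is injective on
  \<open>T\<close>, a leaf that determines \<open>g xs\<close> determines \<open>xs\<close>.\<close>

lemma sortable_simulation:
  assumes "sortable m c S" "g ` T \<subseteq> S" "inj_on g T"
    and "\<And>i j. i < m \<Longrightarrow> \<exists>i' < m'. \<exists>j'. \<forall>xs \<in> T. g xs ! i < j \<longleftrightarrow> xs ! i' < j'"
  shows "sortable m' c T"
  using assms
proof (induction arbitrary: T rule: sortable.induct)
  case (unique S c)
  then show ?case
    by (intro sortable.unique) (meson image_subset_iff inj_onD)
next
  case (query i c S j)
  obtain i' j' where ij: "i' < m'" "\<And>xs. xs \<in> T \<Longrightarrow> g xs ! i < j \<longleftrightarrow> xs ! i' < j'"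
    using query.prems(3)[OF \<open>i < m\<close>] by blast
  show ?case
  proof (rule sortable.query[OF ij(1)])
    show "sortable m' c {xs \<in> T. xs ! i' < j'}"
    proof (rule query.IH(1))
      show "g ` {xs \<in> T. xs ! i' < j'} \<subseteq> {xs \<in> S. xs ! i < j}"
        using query.prems(1) ij(2) by auto
      show "inj_on g {xs \<in> T. xs ! i' < j'}"
        using query.prems(2) by (rule inj_on_subset) auto
    qed (use query.prems(3) in fastforce)
    show "sortable m' c {xs \<in> T. j' \<le> xs ! i'}"
    proof (rule query.IH(2))
      show "g ` {xs \<in> T. j' \<le> xs ! i'} \<subseteq> {xs \<in> S. j \<le> xs ! i}"
        using query.prems(1) ij(2) by (auto simp flip: not_less)
      show "inj_on g {xs \<in> T. j' \<le> xs ! i'}"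
        using query.prems(2) by (rule inj_on_subset) auto
    qed (use query.prems(3) in fastforce)
  qed
qed

lemma sortable_subset: "sortable m c S \<Longrightarrow> T \<subseteq> S \<Longrightarrow> sortable m c T"
  by (rule sortable_simulation[where g = id]) auto

lemma sortable_mono: "sortable m c S \<Longrightarrow> c \<le> d \<Longrightarrow> sortable m d S"
proof (induction arbitrary: d rule: sortable.induct)
  case (query i c S j)
  then show ?case
    by (cases d) (auto intro: sortable.query)
qed (rule sortable.unique)

text \<open>The tree for \<open>S\<close> runs on the first \<open>k\<close> entries; at each of its
  leaves the tree for \<open>T\<close> follows, with indices raised by \<open>k\<close>.\<close>

lemma sortable_append:
  assumes "sortable k c S" "sortable m d T" "\<And>xs. xs \<in> S \<Longrightarrow> length xs = k"
  shows "sortable (k + m) (c + d) {xs @ ys | xs ys. xs \<in> S \<and> ys \<in> T}"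
  using assms(1,3)
proof (induction rule: sortable.induct)
  case (unique S c)
  show ?case
  proof (rule sortable_mono)
    show "sortable (k + m) d {xs @ ys | xs ys. xs \<in> S \<and> ys \<in> T}"
    proof (rule sortable_simulation[OF assms(2), where g = "drop k"])
      show "drop k ` {xs @ ys | xs ys. xs \<in> S \<and> ys \<in> T} \<subseteq> T"
        using unique.prems by auto
      \<comment> \<open>At a leaf at most one prefix remains, so dropping it loses nothing.\<close>
      show "inj_on (drop k) {xs @ ys | xs ys. xs \<in> S \<and> ys \<in> T}"
        using unique by (fastforce simp: inj_on_def)
      show "\<exists>i' < k + m. \<exists>j'. \<forall>zs \<in> {xs @ ys | xs ys. xs \<in> S \<and> ys \<in> T}.
          drop k zs ! i < j \<longleftrightarrow> zs ! i' < j'" if "i < m" for i j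
      proof (intro exI conjI)
        show "\<forall>zs \<in> {xs @ ys | xs ys. xs \<in> S \<and> ys \<in> T}. drop k zs ! i < j \<longleftrightarrow> zs ! (k + i) < j"
          using unique.prems by (auto simp: nth_append)
      qed (use that in simp)
    qed
  qed simp
next
  case (query i c S j)
  have *: "(xs @ ys) ! i = xs ! i" if "xs \<in> S" for xs ys
    using query.prems[OF that] query.hyps(1) by (simp add: nth_append)
  have lt: "sortable (k + m) (c + d) {xs @ ys | xs ys. xs \<in> {xs \<in> S. xs ! i < j} \<and> ys \<in> T}"
    and ge: "sortable (k + m) (c + d) {xs @ ys | xs ys. xs \<in> {xs \<in> S. j \<le> xs ! i} \<and> ys \<in> T}"
    using query.IH query.prems by simp_all
  have "sortable (k + m) (Suc (c + d)) {xs @ ys | xs ys. xs \<in> S \<and> ys \<in> T}"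
  proof (rule sortable.query)
    show "i < k + m"
      using query.hyps(1) by simp
    show "sortable (k + m) (c + d) {zs \<in> {xs @ ys | xs ys. xs \<in> S \<and> ys \<in> T}. zs ! i < j}"
      by (rule sortable_subset[OF lt]) (use * in fastforce)
    show "sortable (k + m) (c + d) {zs \<in> {xs @ ys | xs ys. xs \<in> S \<and> ys \<in> T}. j \<le> zs ! i}"
      by (rule sortable_subset[OF ge]) (use * in fastforce)
  qed
  then show ?case by simp
qed

section \<open>Sorted lists in an interval and the Hwang-Lin bound\<close>

text \<open>For \<open>a \<le> b\<close> these are the position lists for merging \<open>m\<close>
  elements with the \<open>b - a\<close> elements \<open>B (a + 1)\<close>, ...,
  \<open>B b\<close>.\<close>

definition rect :: "nat \<Rightarrow> nat \<Rightarrow> nat \<Rightarrow> nat list set" where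
  "rect m a b = {xs. length xs = m \<and> sorted xs \<and> set xs \<subseteq> {a..b}}"

lemma rect_nth: "xs \<in> rect m a b \<Longrightarrow> i < m \<Longrightarrow> a \<le> xs ! i \<and> xs ! i \<le> b"
  by (auto simp: rect_def dest!: nth_mem)

lemma sortable_rect_shift:
  assumes "sortable m c (rect m 0 n)"
  shows "sortable m c (rect m a (a + n))"
proof (rule sortable_simulation[OF assms, where g = "map (\<lambda>x. x - a)"])
  show "map (\<lambda>x. x - a) ` rect m a (a + n) \<subseteq> rect m 0 n"
    by (auto simp: rect_def sorted_iff_nth_mono diff_le_mono subset_iff le_diff_conv add.commute)
  show "inj_on (map (\<lambda>x. x - a)) (rect m a (a + n))"
    by (rule inj_on_mapI, rule inj_onI) (auto simp: rect_def subset_iff eq_diff_iff)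
  show "\<exists>i' < m. \<exists>j'. \<forall>xs \<in> rect m a (a + n). map (\<lambda>x. x - a) xs ! i < j \<longleftrightarrow> xs ! i' < j'"
    if "i < m" for i j
  proof (cases "j = 0")
    case True
    then show ?thesis using that by (intro exI[of _ i]) auto
  next
    case False
    then show ?thesis
      using that by (intro exI[of _ i] conjI exI[of _ "j + a"]) (auto simp: rect_def)
  qed
qed

text \<open>The first entry is determined on its own; the others are then located in all of
  \<open>{a..b}\<close>, forgetting that the first entry bounds them from below.\<close>

lemma sortable_rect_Cons:
  assumes "sortable 1 c ((\<lambda>x. [x]) ` {a..<a'})" "sortable m d (rect m a b)"
    "\<And>xs. xs \<in> S \<Longrightarrow> xs ! 0 < a'" "S \<subseteq> rect (Suc m) a b"
  shows "sortable (Suc m) (c + d) S"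
proof (rule sortable_subset)
  show "sortable (Suc m) (c + d) {xs @ ys | xs ys. xs \<in> (\<lambda>x. [x]) ` {a..<a'} \<and> ys \<in> rect m a b}"
    unfolding plus_1_eq_Suc[symmetric] by (rule sortable_append[OF assms(1,2)]) auto
  show "S \<subseteq> {xs @ ys | xs ys. xs \<in> (\<lambda>x. [x]) ` {a..<a'} \<and> ys \<in> rect m a b}"
  proof
    fix xs assume "xs \<in> S"
    with assms(3,4) have xs: "xs ! 0 < a'" "xs \<in> rect (Suc m) a b"
      by auto
    then obtain x ys where "xs = [x] @ ys"
      by (cases xs) (auto simp: rect_def)
    moreover from this have "x \<in> {a..<a'}" "ys \<in> rect m a b"
      using xs by (auto simp: rect_def)
    ultimately show "xs \<in> {xs @ ys | xs ys. xs \<in> (\<lambda>x. [x]) ` {a..<a'} \<and> ys \<in> rect m a b}"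
      by blast
  qed
qed

lemma sortable_binary_search: "sortable 1 t ((\<lambda>x. [x]) ` {a..<a + 2 ^ t})"
proof (induction t arbitrary: a)
  case 0
  show ?case by (rule sortable.unique) auto
next
  case (Suc t)
  show ?case
  proof (rule sortable.query[of 0 _ _ _ "a + 2 ^ t"])
    show "sortable 1 t {xs \<in> (\<lambda>x. [x]) ` {a..<a + 2 ^ Suc t}. xs ! 0 < a + 2 ^ t}"
      by (rule sortable_subset[OF Suc.IH[of a]]) auto
    show "sortable 1 t {xs \<in> (\<lambda>x. [x]) ` {a..<a + 2 ^ Suc t}. a + 2 ^ t \<le> xs ! 0}"
      by (rule sortable_subset[OF Suc.IH[of "a + 2 ^ t"]]) auto
  qed simp
qed

lemma rect_query_ge: "{xs \<in> rect (Suc m) a b. a' \<le> xs ! 0} \<subseteq> rect (Suc m) a' b"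
proof
  fix xs assume "xs \<in> {xs \<in> rect (Suc m) a b. a' \<le> xs ! 0}"
  then show "xs \<in> rect (Suc m) a' b"
    by (cases xs) (force simp: rect_def)+
qed

text \<open>One step of Hwang-Lin merging: the first entry is compared with
  \<open>a + 2 ^ t\<close>. If it is smaller, \<open>t\<close> queries locate it; otherwise
  \<open>2 ^ t\<close> elements of the second list are discarded and the quotient drops by one. In
  terms of this quotient, \<open>f\<close> and \<open>g\<close> bound the cost for \<open>m\<close>
  and \<open>Suc m\<close> entries.\<close>

lemma sortable_rect_step:
  assumes "\<And>a. sortable m (f ((b - a) div 2 ^ t)) (rect m a b)"
    and "t + f 0 \<le> g 0" "\<And>q. Suc (t + f (Suc q)) \<le> g (Suc q)" "\<And>q. Suc (g q) \<le> g (Suc q)"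
  shows "sortable (Suc m) (g ((b - a) div 2 ^ t)) (rect (Suc m) a b)"
proof (induction "(b - a) div 2 ^ t" arbitrary: a)
  case 0
  \<comment> \<open>The first entry has at most \<open>2 ^ t\<close> possible values, so the binary
    search starts without the preliminary query.\<close>
  then have "b - a < 2 ^ t"
    by (metis div_eq_0_iff power_not_zero zero_neq_numeral)
  then have "sortable (Suc m) (t + f ((b - a) div 2 ^ t)) (rect (Suc m) a b)"
    by (intro sortable_rect_Cons[OF sortable_binary_search assms(1)])
      (auto dest: rect_nth[where i = 0])
  then show ?case
    using assms(2) 0 by (auto intro: sortable_mono)
next
  case (Suc q)
  define a' where "a' = a + 2 ^ t"
  have "2 ^ t \<le> b - a"
    using Suc.hyps(2) by (metis div_less not_less nat.distinct(1))
  then have "q = (b - a') div 2 ^ t"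
    using Suc.hyps(2) by (simp add: le_div_geq a'_def)
  from Suc.hyps(1)[OF this] have "sortable (Suc m) (g q) (rect (Suc m) a' b)"
    using \<open>q = (b - a') div 2 ^ t\<close> by simp
  then have ge: "sortable (Suc m) (g (Suc q) - 1) {xs \<in> rect (Suc m) a b. a' \<le> xs ! 0}"
    using assms(4)[of q] by (intro sortable_subset[OF _ rect_query_ge]) (auto elim: sortable_mono)
  have "sortable (Suc m) (t + f (Suc q)) {xs \<in> rect (Suc m) a b. xs ! 0 < a'}"
    using assms(1)[of a] unfolding Suc.hyps(2)[symmetric] a'_def
    by (intro sortable_rect_Cons[OF sortable_binary_search]) auto
  then have "sortable (Suc m) (g (Suc q) - 1) {xs \<in> rect (Suc m) a b. xs ! 0 < a'}"
    using assms(3)[of q] by (auto elim: sortable_mono)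
  from sortable.query[OF _ this ge] show ?case
    using assms(3)[of q] Suc.hyps(2) by simp
qed

text \<open>Each full block of \<open>2 ^ t\<close> elements is charged one query, each entry but
  the last \<open>t + 1\<close>. The last entry is charged only \<open>t\<close>: its final
  comparison is paid by a block left over, and is not made if there is none. The case
  \<open>t = 0\<close> is linear merging.\<close>

lemma sortable_rect_Hwang_Lin:
  "sortable (Suc m) (m * Suc t + t + (b - a) div 2 ^ t) (rect (Suc m) a b)"
proof (induction m arbitrary: a)
  case 0
  have "sortable 0 0 (rect 0 a b)" for a
    by (rule sortable.unique) (auto simp: rect_def)
  then show ?case
    using sortable_rect_step[of 0 "\<lambda>_. 0" b t "\<lambda>q. t + q" a] by simp
next
  case (Suc m)
  then show ?case
    using sortable_rect_step[of "Suc m" "\<lambda>q. m * Suc t + t + q" b t "\<lambda>q. Suc m * Suc t + t + q" a]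
    by simp
qed

section \<open>Merging plans\<close>

text \<open>
  A state of a merging procedure is recorded as a box: a list of intervals for the entries of the
  position list. \<open>Query i j p q\<close> asks whether entry \<open>i\<close> is smaller than \<open>j\<close>, \<open>Cut k p q\<close> treats the
  first \<open>k\<close> entries and the others separately, forgetting that they are ordered among each other,
  and \<open>Rect\<close> forgets everything except the common range of all entries.
\<close>

datatype plan = Rect | Cut nat plan plan | Query nat nat plan plan

text \<open>The Hwang--Lin bound, improved by the entries \<open>(m, n, c)\<close> of a table.\<close>

definition rect_bound :: "(nat \<times> nat \<times> nat) list \<Rightarrow> nat \<Rightarrow> nat \<Rightarrow> nat" where
  "rect_bound ks m w = (if m = 0 \<or> w = 0 then 0 else
     min_list ([c. (m', n, c) \<leftarrow> ks, m' = m \<and> w \<le> n] @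
       map (\<lambda>t. (m - 1) * Suc t + t + w div 2 ^ t) [0..<5]))"

text \<open>By sortedness an upper bound on entry \<open>i\<close> spreads to all earlier entries
  and a lower bound to all later ones. A query with index out of range is charged like
  \<open>Rect\<close>, so that every plan is sound for every box.\<close>

primrec plan_cost :: "(nat \<times> nat \<times> nat) list \<Rightarrow> plan \<Rightarrow> (nat \<times> nat) list \<Rightarrow> nat" where
  "plan_cost ks Rect I = rect_bound ks (length I) (snd (last I) - fst (hd I))"
| "plan_cost ks (Cut k p q) I = plan_cost ks p (take k I) + plan_cost ks q (drop k I)"
| "plan_cost ks (Query i j p q) I =
     (if i < length I then
        Suc (max
          (plan_cost ks p (map (\<lambda>(l, h). (l, min h (j - 1))) (take (Suc i) I) @ drop (Suc i) I))
          (plan_cost ks q (take i I @ map (\<lambda>(l, h). (max l j, h)) (drop i I))))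
      else rect_bound ks (length I) (snd (last I) - fst (hd I)))"

definition box :: "(nat \<times> nat) list \<Rightarrow> nat list set" where
  "box I = {xs. length xs = length I \<and> sorted xs \<and>
     (\<forall>i < length I. fst (I ! i) \<le> xs ! i \<and> xs ! i \<le> snd (I ! i))}"

section \<open>Soundness of plans\<close>

text \<open>The minimum is attained, either by a table entry, which also covers all smaller widths,
  or by the Hwang-Lin bound for some \<open>t\<close>.\<close>

lemma sortable_rect_bound:
  assumes "\<And>m n c. (m, n, c) \<in> set ks \<Longrightarrow> sortable m c (rect m 0 n)"
  shows "sortable m (rect_bound ks m (b - a)) (rect m a b)"
proof (cases "m = 0 \<or> b - a = 0")
  case True
  \<comment> \<open>Truncated subtraction lets \<open>b - a = 0\<close> include
    \<open>b < a\<close>; in every case at most one list remains.\<close>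
  have "xs = ys" if "xs \<in> rect m a b" "ys \<in> rect m a b" for xs ys
  proof (rule nth_equalityI)
    show "length xs = length ys"
      using that by (simp add: rect_def)
    show "xs ! i = ys ! i" if "i < length xs" for i
      using rect_nth[OF \<open>xs \<in> _\<close>, of i] rect_nth[OF \<open>ys \<in> _\<close>, of i] that \<open>xs \<in> _\<close> True
      by (auto simp: rect_def)
  qed
  then show ?thesis by (rule sortable.unique)
next
  case False
  then obtain m' where m: "m = Suc m'"
    using not0_implies_Suc by blast
  let ?L = "[c. (m', n, c) \<leftarrow> ks, m' = m \<and> b - a \<le> n] @
    map (\<lambda>t. (m - 1) * Suc t + t + (b - a) div 2 ^ t) [0..<5]"
  have "?L \<noteq> []" by simp
  then have "rect_bound ks m (b - a) \<in> set ?L"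
    using False Min_in[of "set ?L"] unfolding rect_bound_def by (simp add: min_list_Min del: set_append)
  then consider n where "(m, n, rect_bound ks m (b - a)) \<in> set ks" "b - a \<le> n"
    | t where "rect_bound ks m (b - a) = m' * Suc t + t + (b - a) div 2 ^ t"
    unfolding set_append Un_iff
  proof (elim disjE)
    assume "rect_bound ks m (b - a) \<in> set [c. (m', n, c) \<leftarrow> ks, m' = m \<and> b - a \<le> n]"
    then show thesis
      by (auto split: if_splits intro: that(1))
  next
    assume "rect_bound ks m (b - a)
      \<in> set (map (\<lambda>t. (m - 1) * Suc t + t + (b - a) div 2 ^ t) [0..<5])"
    then show thesis
      by (auto simp: m simp del: mult_Suc_right intro: that(2))
  qed
  then show ?thesis
  proof cases
    case 1
    have "rect m a b \<subseteq> rect m a (a + n)"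
      using 1(2) by (auto simp: rect_def subset_iff)
    with sortable_rect_shift[OF assms[OF 1(1)]] show ?thesis
      by (rule sortable_subset)
  next
    case 2
    then show ?thesis
      unfolding m using sortable_rect_Hwang_Lin by metis
  qed
qed

lemma box_subset_rect: "box I \<subseteq> rect (length I) (fst (hd I)) (snd (last I))"
proof
  fix xs assume xs: "xs \<in> box I"
  have "x \<in> {fst (hd I)..snd (last I)}" if x: "x \<in> set xs" for x
  proof -
    obtain i where i: "i < length xs" "x = xs ! i"
      using x by (auto simp: in_set_conv_nth)
    have len: "length xs = length I" and "I \<noteq> []"
      using xs i by (auto simp: box_def)
    have "xs ! 0 \<le> xs ! i" "xs ! i \<le> xs ! (length xs - 1)"
      using xs i by (auto simp: box_def intro!: sorted_nth_mono)
    moreover have "fst (I ! 0) \<le> xs ! 0" "xs ! (length xs - 1) \<le> snd (I ! (length xs - 1))"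
      using xs \<open>I \<noteq> []\<close> by (auto simp: box_def)
    ultimately show ?thesis
      using i len \<open>I \<noteq> []\<close> by (simp add: hd_conv_nth last_conv_nth)
  qed
  then show "xs \<in> rect (length I) (fst (hd I)) (snd (last I))"
    using xs by (auto simp: rect_def box_def)
qed

text \<open>\<open>Rect\<close> enlarges the box to a \<open>rect\<close>, \<open>Cut\<close>
  enlarges it to a product of two boxes, and each answer to a \<open>Query\<close> leads into a
  narrower box.\<close>

lemma sortable_box:
  assumes "\<And>m n c. (m, n, c) \<in> set ks \<Longrightarrow> sortable m c (rect m 0 n)"
  shows "sortable (length I) (plan_cost ks p I) (box I)"
proof (induction p arbitrary: I)
  case Rect
  show ?case
    using sortable_subset[OF sortable_rect_bound box_subset_rect] assms by simp
next
  case (Cut k p q)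
  show ?case
  proof (rule sortable_subset)
    have "sortable (length (take k I) + length (drop k I)) (plan_cost ks (Cut k p q) I)
        {xs @ ys | xs ys. xs \<in> box (take k I) \<and> ys \<in> box (drop k I)}"
      unfolding plan_cost.simps by (rule sortable_append[OF Cut]) (simp add: box_def)
    then show "sortable (length I) (plan_cost ks (Cut k p q) I)
        {xs @ ys | xs ys. xs \<in> box (take k I) \<and> ys \<in> box (drop k I)}"
      by (metis append_take_drop_id length_append)
    show "box I \<subseteq> {xs @ ys | xs ys. xs \<in> box (take k I) \<and> ys \<in> box (drop k I)}"
    proof
      fix xs assume "xs \<in> box I"
      then have "take k xs \<in> box (take k I)" "drop k xs \<in> box (drop k I)"
        by (auto simp: box_def sorted_wrt_take sorted_wrt_drop)
      then show "xs \<in> {xs @ ys | xs ys. xs \<in> box (take k I) \<and> ys \<in> box (drop k I)}"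
        by (metis (mono_tags, lifting) append_take_drop_id mem_Collect_eq)
    qed
  qed
next
  case (Query i j p q)
  let ?lt = "map (\<lambda>(l, h). (l, min h (j - 1))) (take (Suc i) I) @ drop (Suc i) I"
  let ?ge = "take i I @ map (\<lambda>(l, h). (max l j, h)) (drop i I)"
  show ?case
  proof (cases "i < length I")
    case True
    \<comment> \<open>Entries up to \<open>i\<close> are at most \<open>xs ! i\<close>, hence at
      most \<open>j - 1\<close>. For \<open>j = 0\<close> the set on the left is empty, so the
      truncation is harmless.\<close>
    have "{xs \<in> box I. xs ! i < j} \<subseteq> box ?lt"
    proof
      fix xs assume xs: "xs \<in> {xs \<in> box I. xs ! i < j}"
      have "fst (?lt ! i') \<le> xs ! i' \<and> xs ! i' \<le> snd (?lt ! i')" if "i' < length I" for i'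
      proof (cases "i' \<le> i")
        case True
        then have "xs ! i' \<le> xs ! i"
          using xs \<open>i < length I\<close> by (auto simp: box_def intro: sorted_nth_mono)
        then show ?thesis
          using xs that True by (auto simp: box_def nth_append case_prod_beta)
      next
        case False
        then show ?thesis
          using xs that by (auto simp: box_def nth_append)
      qed
      then show "xs \<in> box ?lt"
        using xs True by (simp add: box_def)
    qed
    moreover have "length ?lt = length I"
      using True by simp
    with Query.IH(1)[of ?lt] have "sortable (length I) (plan_cost ks p ?lt) (box ?lt)"
      by (rule back_subst[where P = "\<lambda>n. sortable n _ _"])
    ultimately have lt: "sortable (length I) (plan_cost ks p ?lt) {xs \<in> box I. xs ! i < j}"
      by (rule sortable_subset[rotated])
    have "{xs \<in> box I. j \<le> xs ! i} \<subseteq> box ?ge"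
    proof
      fix xs assume xs: "xs \<in> {xs \<in> box I. j \<le> xs ! i}"
      have "fst (?ge ! i') \<le> xs ! i' \<and> xs ! i' \<le> snd (?ge ! i')" if "i' < length I" for i'
      proof (cases "i \<le> i'")
        case True
        then have "xs ! i \<le> xs ! i'"
          using xs that by (auto simp: box_def intro: sorted_nth_mono)
        then show ?thesis
          using xs that True by (auto simp: box_def nth_append case_prod_beta)
      next
        case False
        then show ?thesis
          using xs that by (auto simp: box_def nth_append)
      qed
      then show "xs \<in> box ?ge"
        using xs True by (simp add: box_def)
    qed
    moreover have "length ?ge = length I"
      using True by simp
    with Query.IH(2)[of ?ge] have "sortable (length I) (plan_cost ks q ?ge) (box ?ge)"
      by (rule back_subst[where P = "\<lambda>n. sortable n _ _"])
    ultimately have ge: "sortable (length I) (plan_cost ks q ?ge) {xs \<in> box I. j \<le> xs ! i}"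
      by (rule sortable_subset[rotated])
    show ?thesis
      using True sortable.query[OF True sortable_mono[OF lt max.cobounded1]
          sortable_mono[OF ge max.cobounded2]] by simp
  next
    case False
    then show ?thesis
      using sortable_subset[OF sortable_rect_bound box_subset_rect] assms by simp
  qed
qed

lemma sortable_rect_plan:
  assumes "plan_cost ks p (replicate m (0, n)) = c"
    and "\<And>m n c. (m, n, c) \<in> set ks \<Longrightarrow> sortable m c (rect m 0 n)"
  shows "sortable m c (rect m 0 n)"
proof (rule sortable_subset)
  have "sortable (length I) (plan_cost ks p I) (box I)" for I
    by (rule sortable_box) (rule assms(2))
  from this[of "replicate m (0, n)"] show "sortable m c (box (replicate m (0, n)))"
    by (simp add: assms(1))
  show "rect m 0 n \<subseteq> box (replicate m (0, n))"
    using rect_nth[of _ m 0 n] by (simp add: rect_def box_def subset_iff)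
qed

text \<open>
  The plans below were found by a computer search; each one may use the bounds established before it.
\<close>

lemma sortable_rect_5_9: "sortable 5 12 (rect 5 0 9)"
proof (rule sortable_rect_plan)
  \<comment> \<open>The answer \<open>2 \<le> xs ! 0\<close> leaves width 7, where linear merging
    costs 11.\<close>
  show "plan_cost []
    (Query 0 2 (Query 4 8 (Query 1 2 (Query 1 1 (Cut 2 Rect Rect) (Cut 1 Rect (Cut 1 Rect
      (Query 0 3 (Query 2 6 (Query 1 3 (Query 1 2 (Cut 2 Rect Rect) (Cut 1 Rect (Cut 1 Rect
      Rect))) (Cut 1 Rect Rect)) (Cut 1 Rect (Cut 1 Rect Rect))) Rect)))) (Cut 1 Rect Rect))
      (Query 2 5 (Cut 4 (Query 1 2 (Query 1 1 (Cut 2 Rect (Query 0 2 (Cut 1 Rect Rect) (Cut 1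
      Rect Rect))) (Cut 1 Rect (Cut 1 Rect (Query 1 6 (Query 1 4 Rect (Cut 1 Rect Rect)) (Cut
      1 Rect Rect))))) (Cut 1 Rect (Cut 2 Rect Rect))) Rect) (Cut 1 Rect (Query 2 8 (Cut 3
      (Cut 1 Rect Rect) Rect) (Query 0 4 (Cut 1 Rect (Query 1 9 (Cut 1 Rect (Cut 1 Rect Rect))
      (Cut 1 Rect Rect))) (Query 2 9 (Cut 2 (Query 0 6 (Cut 1 Rect Rect) Rect) (Cut 1 Rect
      Rect)) (Cut 2 Rect Rect))))))) Rect)
    (replicate 5 (0, 9)) = 12"
    by code_simp
qed simp

lemma sortable_rect_5_11: "sortable 5 13 (rect 5 0 11)"
proof (rule sortable_rect_plan)
  \<comment> \<open>The answer \<open>2 \<le> xs ! 0\<close> now leaves width 9, a table entry. The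
    next two plans descend by 2 in the same way.\<close>
  show "plan_cost [(5, 9, 12)]
    (Query 0 2 (Query 4 10 (Query 4 8 (Query 1 2 (Query 1 1 (Cut 2 Rect Rect) (Cut 1 Rect
      (Cut 1 Rect (Query 0 3 (Query 2 6 (Query 1 3 (Query 1 2 (Cut 2 Rect Rect) (Cut 1 Rect
      (Cut 1 Rect Rect))) (Cut 1 Rect Rect)) (Cut 1 Rect (Cut 1 Rect Rect))) Rect)))) (Cut 1
      Rect Rect)) (Query 2 5 (Cut 4 (Query 1 2 (Query 1 1 (Cut 2 Rect (Query 0 2 (Cut 1 Rect
      Rect) (Cut 1 Rect Rect))) (Cut 1 Rect (Cut 1 Rect (Query 1 6 (Query 1 4 Rect (Cut 1 Rect
      Rect)) (Cut 1 Rect Rect))))) (Cut 1 Rect (Cut 2 Rect Rect))) Rect) (Cut 1 Rect (Query 2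
      8 (Cut 3 (Cut 1 Rect Rect) Rect) (Query 0 4 (Cut 1 Rect (Query 1 9 (Cut 1 Rect (Cut 1
      Rect Rect)) (Cut 1 Rect Rect))) (Query 2 9 (Cut 2 (Query 0 6 (Cut 1 Rect Rect) Rect)
      (Cut 1 Rect Rect)) (Cut 2 Rect Rect))))))) (Query 2 6 (Cut 4 (Query 1 2 (Query 1 1 (Cut
      2 Rect Rect) (Cut 1 Rect (Cut 1 Rect (Query 0 3 (Cut 1 Rect Rect) (Query 0 4 (Cut 1 Rect
      Rect) (Cut 1 Rect Rect)))))) (Cut 1 Rect (Query 1 4 (Cut 1 Rect (Cut 1 Rect Rect)) (Cut
      1 Rect (Cut 1 Rect Rect))))) Rect) (Cut 1 Rect (Query 2 10 (Cut 3 (Query 1 8 (Cut 1 Rect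
      (Cut 1 Rect Rect)) (Cut 1 Rect Rect)) Rect) (Query 1 9 (Cut 2 (Query 1 8 (Cut 1 Rect
      Rect) (Cut 1 Rect Rect)) Rect) (Cut 1 Rect (Query 1 11 (Cut 1 Rect (Cut 1 Rect Rect))
      (Cut 1 Rect Rect)))))))) Rect)
    (replicate 5 (0, 11)) = 13"
    by code_simp
qed (auto intro: sortable_rect_5_9)

lemma sortable_rect_5_13: "sortable 5 14 (rect 5 0 13)"
proof (rule sortable_rect_plan)
  show "plan_cost [(5, 9, 12), (5, 11, 13)]
    (Query 0 2 (Query 2 5 (Query 1 2 (Query 1 1 (Cut 2 Rect (Query 0 2 (Cut 1 Rect Rect) (Cut
      1 Rect Rect))) (Cut 1 Rect (Cut 1 Rect (Query 1 6 (Cut 2 (Query 1 4 Rect (Cut 1 Rect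
      Rect)) Rect) (Cut 1 Rect Rect))))) (Cut 1 Rect (Cut 2 Rect Rect))) (Cut 1 Rect (Query 3
      12 (Query 0 4 (Cut 1 Rect (Query 0 7 (Query 2 10 (Query 1 7 (Query 1 6 (Cut 2 Rect Rect)
      (Cut 1 Rect (Cut 1 Rect Rect))) (Cut 1 Rect Rect)) (Cut 1 Rect (Cut 1 Rect Rect)))
      Rect)) (Query 0 6 (Cut 1 Rect (Query 0 7 (Query 2 10 (Query 1 7 (Query 1 6 (Cut 2 Rect
      Rect) (Cut 1 Rect (Cut 1 Rect Rect))) (Cut 1 Rect Rect)) (Cut 1 Rect (Cut 1 Rect Rect)))
      Rect)) Rect)) (Query 1 9 (Cut 3 (Query 0 4 (Cut 1 Rect (Query 1 10 (Query 1 8 Rect (Cut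
      1 Rect Rect)) (Cut 1 Rect Rect))) (Query 0 6 (Cut 1 Rect (Query 1 10 (Query 1 8 Rect
      (Cut 1 Rect Rect)) (Cut 1 Rect Rect))) (Cut 2 Rect Rect))) Rect) (Cut 1 Rect (Query 1 12
      (Cut 2 Rect Rect) (Query 1 13 (Cut 1 Rect (Cut 1 Rect Rect)) (Cut 1 Rect Rect))))))))
      Rect)
    (replicate 5 (0, 13)) = 14"
    by code_simp
qed (auto intro: sortable_rect_5_9 sortable_rect_5_11)

lemma sortable_rect_5_15: "sortable 5 15 (rect 5 0 15)"
proof (rule sortable_rect_plan)
  show "plan_cost [(5, 9, 12), (5, 11, 13), (5, 13, 14)]
    (Query 0 2 (Query 3 10 (Query 3 7 (Cut 4 (Query 1 2 (Query 1 1 (Cut 2 Rect Rect) (Cut 1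
      Rect (Cut 1 Rect Rect))) (Cut 1 Rect Rect)) Rect) (Cut 1 Rect (Query 1 6 (Cut 2 Rect
      (Query 0 8 (Cut 1 Rect Rect) (Cut 1 Rect Rect))) (Query 1 8 (Cut 2 (Cut 1 Rect Rect)
      (Query 0 8 (Cut 1 Rect Rect) (Cut 1 Rect Rect))) (Cut 1 Rect (Cut 1 Rect (Cut 1 Rect
      Rect))))))) (Cut 1 Rect (Query 0 4 (Cut 1 Rect (Cut 1 Rect Rect)) (Query 1 10 (Cut 2
      Rect Rect) (Query 1 12 (Cut 1 Rect (Cut 1 Rect Rect)) (Cut 1 Rect Rect)))))) Rect)
    (replicate 5 (0, 15)) = 15"
    by code_simp
qed (auto intro: sortable_rect_5_9 sortable_rect_5_11 sortable_rect_5_13)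

lemma sortable_rect_5_17: "sortable 5 16 (rect 5 0 17)"
proof (rule sortable_rect_plan)
  \<comment> \<open>From here on the first query is on entry 1. The answers
    \<open>5 \<le> xs ! 1\<close> and \<open>4 \<le> xs ! 0\<close> spend two queries and leave
    width 13, two table entries further down.\<close>
  show "plan_cost [(5, 9, 12), (5, 11, 13), (5, 13, 14), (5, 15, 15)]
    (Query 1 5 (Query 4 14 Rect (Query 1 3 (Cut 2 Rect (Cut 2 (Query 0 6 (Query 0 2 (Cut 1
      Rect Rect) (Cut 1 Rect Rect)) Rect) Rect)) (Query 1 4 (Cut 1 Rect (Cut 1 Rect (Cut 1
      Rect (Cut 1 Rect Rect)))) (Cut 1 Rect (Cut 1 Rect (Query 0 8 (Cut 1 Rect (Cut 1 Rect
      Rect)) (Query 1 14 (Cut 2 Rect Rect) (Query 1 16 (Cut 1 Rect (Cut 1 Rect Rect)) (Cut 1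
      Rect Rect))))))))) (Query 0 4 (Cut 1 Rect (Query 1 10 (Query 1 8 (Query 0 6 (Cut 1 Rect
      (Query 0 6 (Cut 1 Rect Rect) (Cut 1 Rect Rect))) (Cut 1 Rect (Cut 1 Rect Rect))) (Query
      1 9 (Cut 1 Rect (Cut 1 Rect Rect)) (Cut 1 Rect (Cut 1 Rect (Query 0 12 (Query 0 10 (Cut
      1 Rect Rect) (Cut 1 Rect Rect)) Rect))))) (Query 0 9 (Cut 1 Rect Rect) (Query 0 11 (Cut
      1 Rect Rect) Rect)))) Rect))
    (replicate 5 (0, 17)) = 16"
    by code_simp
qed (auto intro: sortable_rect_5_9 sortable_rect_5_11 sortable_rect_5_13 sortable_rect_5_15)

lemma sortable_rect_5_19: "sortable 5 17 (rect 5 0 19)"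
proof (rule sortable_rect_plan)
  show "plan_cost [(5, 9, 12), (5, 11, 13), (5, 13, 14), (5, 15, 15), (5, 17, 16)]
    (Query 1 6 (Query 4 16 Rect (Cut 4 (Query 2 8 (Query 2 4 (Cut 1 Rect (Cut 1 Rect (Cut 1
      Rect Rect))) (Cut 2 Rect (Cut 1 Rect Rect))) (Cut 2 Rect Rect)) Rect)) (Query 0 4 (Cut 1
      Rect Rect) Rect))
    (replicate 5 (0, 19)) = 17"
    by code_simp
qed (auto intro: sortable_rect_5_9 sortable_rect_5_11 sortable_rect_5_13 sortable_rect_5_15 sortable_rect_5_17)

lemma sortable_rect_5_21: "sortable 5 18 (rect 5 0 21)"
proof (rule sortable_rect_plan)
  show "plan_cost [(5, 9, 12), (5, 11, 13), (5, 13, 14), (5, 15, 15), (5, 17, 16), (5, 19, 17)]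
    (Query 1 6 (Query 2 6 (Cut 3 Rect Rect) (Cut 2 Rect Rect)) (Query 0 4 (Cut 1 Rect Rect)
      Rect))
    (replicate 5 (0, 21)) = 18"
    by code_simp
qed (auto intro: sortable_rect_5_9 sortable_rect_5_11 sortable_rect_5_13 sortable_rect_5_15 sortable_rect_5_17 sortable_rect_5_19)

section \<open>From position lists to merging algorithms\<close>

definition positions :: "nat \<Rightarrow> nat \<Rightarrow> elt rel \<Rightarrow> nat list" where
  "positions m n r = map (\<lambda>i. card {j \<in> {1..n}. (B j, A i) \<in> r}) [1..<Suc m]"

lemma interleavingsD:
  assumes "r \<in> interleavings m n"
  shows "r \<subseteq> elts m n \<times> elts m n" "(x, x) \<notin> r" "(x, y) \<in> r \<Longrightarrow> (y, z) \<in> r \<Longrightarrow> (x, z) \<in> r"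
    and "x \<in> elts m n \<Longrightarrow> y \<in> elts m n \<Longrightarrow> x \<noteq> y \<Longrightarrow> (x, y) \<in> r \<longleftrightarrow> (y, x) \<notin> r"
    and "1 \<le> i \<Longrightarrow> i < j \<Longrightarrow> j \<le> m \<Longrightarrow> (A i, A j) \<in> r"
    and "1 \<le> i \<Longrightarrow> i < j \<Longrightarrow> j \<le> n \<Longrightarrow> (B i, B j) \<in> r"
proof -
  have r: "r \<subseteq> elts m n \<times> elts m n" "trans r" "irrefl r" "total_on (elts m n) r"
    using assms by (auto simp: interleavings_def strict_linear_order_on_def)
  show "r \<subseteq> elts m n \<times> elts m n" "(x, x) \<notin> r"
    and "(x, y) \<in> r \<Longrightarrow> (y, z) \<in> r \<Longrightarrow> (x, z) \<in> r"
    using r by (auto simp: irrefl_def dest: transD)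
  show "x \<in> elts m n \<Longrightarrow> y \<in> elts m n \<Longrightarrow> x \<noteq> y \<Longrightarrow> (x, y) \<in> r \<longleftrightarrow> (y, x) \<notin> r"
    using r by (meson irrefl_def total_on_def transD)
qed (use assms in \<open>auto simp: interleavings_def\<close>)

text \<open>The elements \<open>B j\<close> below \<open>A (Suc i)\<close> form an initial segment
  of the second list, so their number decides every comparison of \<open>A (Suc i)\<close> with that
  list.\<close>

lemma less_iff_positions:
  assumes r: "r \<in> interleavings m n" and "i < m" "1 \<le> j" "j \<le> n"
  shows "(A (Suc i), B j) \<in> r \<longleftrightarrow> positions m n r ! i < j"
proof -
  note D = interleavingsD[OF r]
  let ?X = "{j \<in> {1..n}. (B j, A (Suc i)) \<in> r}"
  have nth: "positions m n r ! i = card ?X"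
    using \<open>i < m\<close> by (simp add: positions_def del: upt_Suc)
  have iff: "(A (Suc i), B j) \<in> r \<longleftrightarrow> (B j, A (Suc i)) \<notin> r"
    using assms by (intro D(4)) (auto simp: elts_def)
  show ?thesis
  proof
    assume less: "(A (Suc i), B j) \<in> r"
    have "?X \<subseteq> {1..<j}"
    proof
      fix j' assume j': "j' \<in> ?X"
      then have "(B j', B j) \<in> r"
        using less D(3) by blast
      then have "\<not> j \<le> j'"
        using D(2,3) D(6)[of j j'] j' assms by (auto simp: le_less)
      with j' show "j' \<in> {1..<j}" by simp
    qed
    then have "card ?X \<le> card {1..<j}"
      by (rule card_mono[rotated]) simp
    with nth \<open>1 \<le> j\<close> show "positions m n r ! i < j" by simp
  next
    assume less: "positions m n r ! i < j"
    show "(A (Suc i), B j) \<in> r"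
    proof (rule ccontr)
      assume "(A (Suc i), B j) \<notin> r"
      then have j: "(B j, A (Suc i)) \<in> r"
        using iff by simp
      have "{1..j} \<subseteq> ?X"
        using D(3)[OF D(6) j] j assms by (auto simp: le_less)
      then have "card {1..j} \<le> card ?X"
        by (rule card_mono[rotated]) simp
      with nth less show False by simp
    qed
  qed
qed

lemma positions_in_rect:
  assumes r: "r \<in> interleavings m n"
  shows "positions m n r \<in> rect m 0 n"
proof -
  have "card {j \<in> {1..n}. (B j, x) \<in> r} \<le> card {1..n}" for x
    by (rule card_mono) auto
  moreover have "card {j \<in> {1..n}. (B j, A i) \<in> r} \<le> card {j \<in> {1..n}. (B j, A k) \<in> r}"
    if "1 \<le> i" "i \<le> k" "k \<le> m" for i k
  proof (cases "i = k")
    case False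
    then have "(A i, A k) \<in> r"
      using that interleavingsD(5)[OF r] by simp
    then show ?thesis
      using interleavingsD(3)[OF r, of _ "A i" "A k"] by (intro card_mono) auto
  qed simp
  ultimately show ?thesis
    by (auto simp: rect_def positions_def sorted_iff_nth_mono simp del: upt_Suc)
qed

text \<open>Comparisons within one list have the same answer in all interleavings; those across the
  lists are determined by the positions.\<close>

lemma inj_on_positions: "inj_on (positions m n) (interleavings m n)"
proof (rule inj_onI)
  \<comment> \<open>The roles of \<open>r\<close> and \<open>s\<close> can be exchanged, so one
    inclusion suffices.\<close>
  have subset: "r \<subseteq> s" if r: "r \<in> interleavings m n" and s: "s \<in> interleavings m n"
    and eq: "positions m n r = positions m n s" for r s
  proof
    fix p assume "p \<in> r"
    then obtain x y where p: "p = (x, y)" "(x, y) \<in> r" by (cases p) auto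
    then have xy: "x \<in> elts m n" "y \<in> elts m n" "x \<noteq> y" "(y, x) \<notin> r"
      using interleavingsD(1-4)[OF r] by blast+
    have cross: "(A i, B j) \<in> r \<longleftrightarrow> (A i, B j) \<in> s" if "A i \<in> elts m n" "B j \<in> elts m n" for i j
      using that less_iff_positions[OF r, of "i - 1" j] less_iff_positions[OF s, of "i - 1" j] eq
      by (auto simp: elts_def)
    show "p \<in> s"
    proof (cases x)
      case x: (A i)
      show ?thesis
      proof (cases y)
        case y: (A j)
        then have "i < j"
          using x xy interleavingsD(5)[OF r, of j i]
            by (cases i j rule: linorder_cases) (auto simp: elts_def)
        then show ?thesis
          using x y xy p interleavingsD(5)[OF s, of i j] by (auto simp: elts_def)
      next
        case (B j)
        then show ?thesis
          using cross x xy p by simp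
      qed
    next
      case x: (B i)
      show ?thesis
      proof (cases y)
        case (A j)
        then show ?thesis
          using cross[of j i] x xy p interleavingsD(4)[OF s, of x y] by auto
      next
        case y: (B j)
        then have "i < j"
          using x xy interleavingsD(6)[OF r, of j i]
            by (cases i j rule: linorder_cases) (auto simp: elts_def)
        then show ?thesis
          using x y xy p interleavingsD(6)[OF s, of i j] by (auto simp: elts_def)
      qed
    qed
  qed
  fix r s assume "r \<in> interleavings m n" "s \<in> interleavings m n"
    "positions m n r = positions m n s"
  then show "r = s"
    using subset by (metis subset_antisym)
qed

lemma sortable_imp_alg:
  assumes "sortable m c S"
  shows "\<exists>t. valid_alg (elts m n) t \<and>
    (\<forall>r \<in> interleavings m n. positions m n r \<in> S \<longrightarrow> result t r = r \<and> comparisons t r \<le> c)"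
  using assms
proof (induction rule: sortable.induct)
  case (unique S c)
  show ?case
  proof (cases "\<exists>r \<in> interleavings m n. positions m n r \<in> S")
    case True
    \<comment> \<open>By injectivity of \<open>positions\<close>, \<open>r\<close> is the only
      interleaving whose positions lie in \<open>S\<close>, so a leaf may output it.\<close>
    then obtain r where "r \<in> interleavings m n" "positions m n r \<in> S" by blast
    then show ?thesis
      using unique inj_on_positions[of m n]
      by (intro exI[of _ "Output r"]) (auto simp: inj_on_def)
  next
    case False
    then show ?thesis by (intro exI[of _ "Output {}"]) auto
  qed
next
  case (query i c S j)
  obtain t where t: "valid_alg (elts m n) t" "\<And>r. r \<in> interleavings m n \<Longrightarrow>
      positions m n r \<in> S \<Longrightarrow> positions m n r ! i < j \<Longrightarrow> result t r = r \<and> comparisons t r \<le> c"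
    using query.IH(1) by auto
  obtain u where u: "valid_alg (elts m n) u" "\<And>r. r \<in> interleavings m n \<Longrightarrow>
      positions m n r \<in> S \<Longrightarrow> j \<le> positions m n r ! i \<Longrightarrow> result u r = r \<and> comparisons u r \<le> c"
    using query.IH(2) by auto
  \<comment> \<open>For \<open>j = 0\<close> or \<open>n < j\<close> there is no element
    \<open>B j\<close>, but then all interleavings give the same answer and one subtree
    suffices.\<close>
  consider "j = 0" | "1 \<le> j" "j \<le> n" | "n < j" by linarith
  then show ?case
  proof cases
    case 1
    then show ?thesis using u by (intro exI[of _ u]) (auto intro: le_SucI)
  next
    case 2
    then show ?thesis
      using t u \<open>i < m\<close> by (intro exI[of _ "Compare (A (Suc i)) (B j) t u"])
        (auto simp: less_iff_positions elts_def)
  next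
    case 3
    then have "positions m n r ! i < j" if "r \<in> interleavings m n" for r
      using rect_nth[OF positions_in_rect[OF that] \<open>i < m\<close>] by simp
    then show ?thesis using t by (intro exI[of _ t]) (auto intro: le_SucI)
  qed
qed

lemma M_le:
  assumes "sortable m c (rect m 0 n)"
  shows "M m n \<le> c"
proof -
  obtain t where "valid_alg (elts m n) t" "\<forall>r \<in> interleavings m n.
      positions m n r \<in> rect m 0 n \<longrightarrow> result t r = r \<and> comparisons t r \<le> c"
    using sortable_imp_alg[OF assms, of n] by auto
  then have t: "valid_alg (elts m n) t"
    "\<And>r. r \<in> interleavings m n \<Longrightarrow> result t r = r \<and> comparisons t r \<le> c"
    by (simp_all add: positions_in_rect)
  then have "M m n \<le> worst_case m n t"
    unfolding M_def by (intro Least_le) (auto simp: merge_alg_def)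
  also have "\<dots> \<le> c"
    using t finite_interleavings interleavings_nonempty by (auto simp: worst_case_def)
  finally show ?thesis .
qed

section \<open>The upper bound\<close>

lemma sortable_rect_add2:
  assumes "sortable (Suc m) c (rect (Suc m) 0 n)" "sortable m (c - 1) (rect m 0 (n + 2))" "c > 0"
  shows "sortable (Suc m) (Suc c) (rect (Suc m) 0 (n + 2))"
proof (rule sortable.query[of 0 _ _ _ 2])
  \<comment> \<open>One query tells the values 0 and 1 of the first entry apart; the other
    \<open>m\<close> entries keep the full range.\<close>
  have "sortable (Suc m) (1 + (c - 1)) {xs \<in> rect (Suc m) 0 (n + 2). xs ! 0 < 2}"
    using sortable_binary_search[of 1 0]
    by (intro sortable_rect_Cons[OF _ assms(2), of _ 2]) (auto simp: numeral_2_eq_2)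
  then show "sortable (Suc m) c {xs \<in> rect (Suc m) 0 (n + 2). xs ! 0 < 2}"
    using \<open>c > 0\<close> by simp
  show "sortable (Suc m) c {xs \<in> rect (Suc m) 0 (n + 2). 2 \<le> xs ! 0}"
    using sortable_subset[OF sortable_rect_shift[OF assms(1), of 2] rect_query_ge]
    by (simp add: add.commute)
qed simp

lemma sortable_rect_5: "sortable 5 (11 + k) (rect 5 0 (7 + 2 * k))"
proof -
  consider "k = 0" | "k = 1" | "k = 2" | "k = 3" | "k = 4" | "k = 5" | "k = 6" | "k = 7" | "k \<ge> 8"
    by linarith
  then show ?thesis
  proof cases
    case 1
    then show ?thesis using sortable_rect_Hwang_Lin[of 4 0 7 0] by simp
  next
    \<comment> \<open>With \<open>t = 2\<close> the Hwang-Lin bound is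
      \<open>14 + (7 + 2 * k) div 4\<close>, which is at most \<open>11 + k\<close> exactly when
      \<open>k \<ge> 8\<close>.\<close>
    case 9
    then show ?thesis
      using sortable_rect_Hwang_Lin[of 4 2 "7 + 2 * k" 0] by (auto elim!: sortable_mono)
  qed (use sortable_rect_5_9 sortable_rect_5_11 sortable_rect_5_13 sortable_rect_5_15
      sortable_rect_5_17 sortable_rect_5_19 sortable_rect_5_21 in simp_all)
qed

text \<open>Here \<open>k\<close> is one more than in the theorem. The induction on \<open>m\<close>
  keeps \<open>k\<close> arbitrary because the recursion leads from \<open>(Suc m, Suc k)\<close> to
  \<open>(Suc m, k)\<close> and \<open>(m, k + 2)\<close>.\<close>

lemma sortable_rect_ge_5:
  assumes "5 \<le> m"
  shows "sortable m (3 * m + k - 4) (rect m 0 (2 * m + 2 * k - 3))"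
  using assms
proof (induction m arbitrary: k rule: dec_induct)
  case base
  show ?case using sortable_rect_5[of k] by (simp add: add.commute)
next
  case (step m)
  show ?case
  proof (induction k)
    case 0
    \<comment> \<open>Linear merging costs \<open>m + (2 * Suc m - 3)\<close>, exactly
      \<open>3 * Suc m - 4\<close>.\<close>
    show ?case
      using sortable_rect_Hwang_Lin[of m 0 "2 * Suc m - 3" 0] step.hyps
      by (auto elim!: sortable_mono)
  next
    case (Suc k)
    have "sortable m (3 * m + Suc (Suc k) - 4) (rect m 0 (2 * m + 2 * Suc (Suc k) - 3))"
      by (rule step.IH)
    moreover have "3 * m + Suc (Suc k) - 4 = 3 * Suc m + k - 4 - 1"
      "2 * m + 2 * Suc (Suc k) - 3 = 2 * Suc m + 2 * k - 3 + 2"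
      "3 * Suc m + Suc k - 4 = Suc (3 * Suc m + k - 4)"
      "2 * Suc m + 2 * Suc k - 3 = 2 * Suc m + 2 * k - 3 + 2" "0 < 3 * Suc m + k - 4"
      using step.hyps by simp_all
    ultimately show ?case
      using sortable_rect_add2[OF Suc.IH] by metis
  qed
qed

theorem theorem7:
  fixes m :: nat and k :: int
  assumes "m \<ge> 5" and "k \<ge> -1"
  shows "int (M m (nat (2 * int m + 2 * k - 1))) \<le> 3 * int m + k - 3"
proof -
  \<comment> \<open>The shift makes the parameter a natural number; \<open>m \<ge> 5\<close> rules
    out truncation in \<open>2 * m + 2 * l - 3\<close>.\<close>
  define l where "l = nat (k + 1)"
  have k: "k = int l - 1"
    using \<open>k \<ge> -1\<close> by (simp add: l_def)
  have "M m (2 * m + 2 * l - 3) \<le> 3 * m + l - 4"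
    by (intro M_le sortable_rect_ge_5 \<open>m \<ge> 5\<close>)
  moreover have "nat (2 * int m + 2 * k - 1) = 2 * m + 2 * l - 3"
    using \<open>m \<ge> 5\<close> k by simp
  ultimately show ?thesis
    using \<open>m \<ge> 5\<close> k by simp
qed

end
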